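(* Let $X$ be a separable infinite-dimensional $F$-space over $\mathbb{K}\in\{\mathbb{R},\mathbb{C}\}$ and let $T$ be a continuous linear operator on $X$. Then every maximal (with respect to inclusion) collection of operators in $\mathcal{L}(X)$ simultaneously approximated by $T$ is an SOT-closed affine manifold in $\mathcal{L}(X)$.
   Context: An $F$-space is a completely metrizable topological vector space. $\mathcal{L}(X)$ is the space of continuous linear operators on $X$; SOT is the strong operator topology (pointwise convergence). For a continuous linear operator $S$ on an $F$-space $Y$, $\Sigma(S)$ is the set of $h\in\mathcal{L}(Y)$ such that the set of $y\in Y$ for which there is a strictly increasing sequence of positive integers $(\omega_n)_n$ with $S^{\omega_n}y\to h(y)$ is dense in $Y$. A collection $\{h_\ell\}_{\ell\in J}\subset\mathcal{L}(X)$ is simultaneously approximated by $T$ if for every $n\in\mathbb{N}$ and all members $g_1,\dots,g_n$ of the collection (repetitions allowed), the coordinatewise map $(g_1,\dots,g_n):X^n\to X^n$ belongs to $\Sigma\left(\bigoplus_{i=1}^nT\right)$, where $\bigoplus_{i=1}^nT$ acts coordinatewise on $X^n$. A subset $M$ of a $\mathbb{K}$-vector space is an affine manifold if $(1-t)x+ty\in M$ for all $x,y\in M$ and $t\in\mathbb{K}$. *)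

theory Defs
  imports "HOL-Analysis.Analysis" "HOL-Library.Function_Algebras"
begin

text \<open>
  The library has no topological vector spaces over a variable scalar field. An $F$-space is a type
  carrying a topological abelian group structure together with an explicit scalar multiplication
  by a normed field (below, the reals or the complex numbers).
\<close>

locale F_space = vector_space smul
  for smul :: "'k::real_normed_field \<Rightarrow> 'a::topological_ab_group_add \<Rightarrow> 'a" +
  assumes continuous_scale: "continuous_on UNIV (\<lambda>(c, x). smul c x)"
    and completely_metrizable: "completely_metrizable_space (euclidean :: 'a topology)"

definition infinite_dimensional ::
    "('k::field \<Rightarrow> 'a::ab_group_add \<Rightarrow> 'a) \<Rightarrow> bool" where
  "infinite_dimensional smul \<longleftrightarrow> \<not> (\<exists>B. finite B \<and> module.span smul B = UNIV)"

text \<open>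
  Powers of \<open>X\<close> of varying exponent cannot be separate types, so the domain of an operator is a
  linear subspace \<open>V\<close> of an ambient type with the induced topology. Operators on \<open>V\<close> are total
  functions on the ambient type whose values outside \<open>V\<close> are irrelevant; for \<open>V = UNIV\<close> these
  are exactly the continuous linear operators.
\<close>

definition cont_lin_ops ::
    "('k \<Rightarrow> 'b::{ab_group_add,topological_space} \<Rightarrow> 'b) \<Rightarrow> 'b set \<Rightarrow> ('b \<Rightarrow> 'b) set" where
  "cont_lin_ops smul V = {h. h ` V \<subseteq> V \<and>
     (\<forall>x\<in>V. \<forall>y\<in>V. h (x + y) = h x + h y) \<and>
     (\<forall>c. \<forall>x\<in>V. h (smul c x) = smul c (h x)) \<and>
     continuous_on V h}"

lemma cont_lin_ops_UNIV:
  assumes "vector_space smul"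
  shows "cont_lin_ops smul UNIV = {h. Vector_Spaces.linear smul smul h \<and> continuous_on UNIV h}"
  using assms unfolding cont_lin_ops_def Vector_Spaces.linear_iff by auto

definition Sigma_ops ::
    "('k \<Rightarrow> 'b::{ab_group_add,topological_space} \<Rightarrow> 'b) \<Rightarrow> 'b set \<Rightarrow> ('b \<Rightarrow> 'b) \<Rightarrow> ('b \<Rightarrow> 'b) set" where
  "Sigma_ops smul V S = {h \<in> cont_lin_ops smul V.
     V \<subseteq> closure {y \<in> V. \<exists>\<omega>::nat \<Rightarrow> nat. strict_mono \<omega> \<and> (\<forall>n. \<omega> n > 0) \<and>
                          (\<lambda>n. (S ^^ \<omega> n) y) \<longlonglongrightarrow> h y}}"

text \<open>
  \<open>power_space n\<close> models $X^n$ as the sequences vanishing from index \<open>n\<close> on. The function type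
  carries the product topology and, by \<^theory>\<open>HOL-Library.Function_Algebras\<close>, pointwise addition.
\<close>

definition power_space :: "nat \<Rightarrow> (nat \<Rightarrow> 'a::zero) set" where
  "power_space n = {x. \<forall>i\<ge>n. x i = 0}"

definition pointwise_scale :: "('k \<Rightarrow> 'a \<Rightarrow> 'a) \<Rightarrow> 'k \<Rightarrow> ('i \<Rightarrow> 'a) \<Rightarrow> ('i \<Rightarrow> 'a)" where
  "pointwise_scale smul c f = (\<lambda>i. smul c (f i))"

definition coordwise :: "nat \<Rightarrow> (nat \<Rightarrow> 'a \<Rightarrow> 'a) \<Rightarrow> (nat \<Rightarrow> 'a) \<Rightarrow> (nat \<Rightarrow> 'a::zero)" where
  "coordwise n g x = (\<lambda>i. if i < n then g i (x i) else 0)"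

definition simultaneously_approximated ::
    "('k \<Rightarrow> 'a::{ab_group_add,topological_space} \<Rightarrow> 'a) \<Rightarrow> ('a \<Rightarrow> 'a) \<Rightarrow> ('a \<Rightarrow> 'a) set \<Rightarrow> bool" where
  "simultaneously_approximated smul T H \<longleftrightarrow> H \<subseteq> cont_lin_ops smul UNIV \<and>
     (\<forall>n\<ge>1. \<forall>g. (\<forall>i<n. g i \<in> H) \<longrightarrow>
        coordwise n g \<in> Sigma_ops (pointwise_scale smul) (power_space n) (coordwise n (\<lambda>_. T)))"

definition maximal_simultaneously_approximated ::
    "('k \<Rightarrow> 'a::{ab_group_add,topological_space} \<Rightarrow> 'a) \<Rightarrow> ('a \<Rightarrow> 'a) \<Rightarrow> ('a \<Rightarrow> 'a) set \<Rightarrow> bool" where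
  "maximal_simultaneously_approximated smul T M \<longleftrightarrow> simultaneously_approximated smul T M \<and>
     (\<forall>M'. simultaneously_approximated smul T M' \<and> M \<subseteq> M' \<longrightarrow> M' = M)"

text \<open>
  The library's \<open>strong_operator_topology\<close> is restricted to bounded operators between normed
  spaces. Here it is the topology of pointwise convergence on the set of continuous linear operators.
\<close>

definition SOT ::
    "('k \<Rightarrow> 'a::{ab_group_add,topological_space} \<Rightarrow> 'a) \<Rightarrow> ('a \<Rightarrow> 'a) topology" where
  "SOT smul = subtopology (product_topology (\<lambda>_. euclidean) UNIV) (cont_lin_ops smul UNIV)"

text \<open>The library's \<open>affine\<close> only allows real scalars.\<close>

definition affine_manifold ::
    "('k::ring_1 \<Rightarrow> 'v::ab_group_add \<Rightarrow> 'v) \<Rightarrow> 'v set \<Rightarrow> bool" where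
  "affine_manifold smul M \<longleftrightarrow> (\<forall>x\<in>M. \<forall>y\<in>M. \<forall>t. smul (1 - t) x + smul t y \<in> M)"

end

theory Submission
  imports Defs
begin

text \<open>
  Being simultaneously approximated is a property of graphs. A collection \<open>H\<close> of operators is
  simultaneously approximated by \<open>T\<close> if and only if every finite family of open subsets of
  $X \times X$ that all meet the union \<open>G\<close> of the graphs of the members of \<open>H\<close> is met, member by
  member, by the graph of a single power $T^m$, with \<open>m\<close> as large as desired. One direction is
  immediate from the density in the definition of \<open>Sigma_ops\<close>; the other is a Baire category
  argument in the completely metrizable space $X^n$
  (\<open>simultaneously_approximated_imp_jointly_approximable\<close> and
  \<open>jointly_approximable_imp_simultaneously_approximated\<close>).

  The condition on \<open>G\<close> makes sense for any set of pairs, and it survives two enlargements: it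
  passes to the closure of \<open>G\<close>, because an open set that meets the closure meets \<open>G\<close>, and to the
  set of all $c p + d q$ with $p, q \in G$, because the graph of $T^m$ is a linear subspace of
  $X \times X$ and linear combinations are continuous. If \<open>M\<close> is maximal with union of graphs \<open>G\<close>,
  then \<open>M\<close> therefore consists of all operators whose graph lies in the closure of \<open>G\<close>, and also of
  all operators whose graph lies in the set of combinations
  (\<open>maximal_simultaneously_approximated_eq\<close>). The first description is a closed condition under
  pointwise convergence. The second contains $(1-t) a + t b$ for $a, b \in M$, since
  $(x, (1-t) a x + t b x) = (1-t) (x, a x) + t (x, b x)$.
\<close>

section \<open>Joint approximation of a set of pairs\<close>

text \<open>
  The points of \<open>G\<close> are approximated, finitely many at a time, by points \<open>(y, T\<^sup>m y)\<close> with a common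
  and arbitrarily large exponent \<open>m\<close>; the base points \<open>y\<close> may differ. Neighbourhoods of points
  of \<open>G\<close> are encoded as open sets that meet \<open>G\<close>.
\<close>
definition jointly_approximable ::
    "('a::topological_space \<Rightarrow> 'a) \<Rightarrow> ('a \<times> 'a) set \<Rightarrow> bool" where
  "jointly_approximable T G \<longleftrightarrow>
     (\<forall>\<W> N. finite \<W> \<and> (\<forall>W\<in>\<W>. open W \<and> W \<inter> G \<noteq> {}) \<longrightarrow>
        (\<exists>m>N. \<forall>W\<in>\<W>. \<exists>y. (y, (T ^^ m) y) \<in> W))"

lemma jointly_approximableE:
  assumes "jointly_approximable T G" "finite \<W>" "\<And>W. W \<in> \<W> \<Longrightarrow> open W \<and> W \<inter> G \<noteq> {}"
  obtains m where "m > N" "\<forall>W\<in>\<W>. \<exists>y. (y, (T ^^ m) y) \<in> W"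
  using assms unfolding jointly_approximable_def by metis

text \<open>The union of the graphs of the members of a collection of maps.\<close>
definition graphs :: "('a \<Rightarrow> 'a) set \<Rightarrow> ('a \<times> 'a) set" where
  "graphs H = {(x, h x) | x h. h \<in> H}"

lemma graphsI: "h \<in> H \<Longrightarrow> (x, h x) \<in> graphs H"
  by (auto simp: graphs_def)

lemma jointly_approximable_mono:
  assumes "jointly_approximable T G" "G' \<subseteq> G"
  shows "jointly_approximable T G'"
  unfolding jointly_approximable_def
proof (intro allI impI)
  fix \<W> :: "('a \<times> 'a) set set" and N :: nat
  assume "finite \<W> \<and> (\<forall>W\<in>\<W>. open W \<and> W \<inter> G' \<noteq> {})"
  then have "finite \<W> \<and> (\<forall>W\<in>\<W>. open W \<and> W \<inter> G \<noteq> {})"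
    using assms(2) by blast
  then show "\<exists>m>N. \<forall>W\<in>\<W>. \<exists>y. (y, (T ^^ m) y) \<in> W"
    using assms(1) unfolding jointly_approximable_def by blast
qed

lemma jointly_approximable_closure:
  assumes "jointly_approximable T G"
  shows "jointly_approximable T (closure G)"
  using assms unfolding jointly_approximable_def
  by (metis open_Int_closure_eq_empty)

lemma funpow_cont_lin_ops:
  assumes "T \<in> cont_lin_ops smul UNIV"
  shows "T ^^ m \<in> cont_lin_ops smul UNIV"
proof (induction m)
  case 0
  show ?case by (simp add: cont_lin_ops_def)
next
  case (Suc m)
  then have "continuous_on UNIV (T \<circ> (T ^^ m))"
    using assms by (intro continuous_on_compose) (auto simp: cont_lin_ops_def intro: continuous_on_subset)
  with Suc assms show ?case by (simp add: cont_lin_ops_def)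
qed

context F_space
begin

lemma continuous_on_scale [continuous_intros]:
  "continuous_on S f \<Longrightarrow> continuous_on S (\<lambda>x. smul c (f x))"
  using continuous_on_compose2[OF continuous_scale, of S "\<lambda>x. (c, f x)"]
  by (simp add: continuous_on_Pair continuous_on_const)

text \<open>
  The linear combinations of two points of \<open>G\<close> in $X \times X$. The set contains \<open>G\<close>, but is in
  general not the span of \<open>G\<close>.
\<close>
definition pair_combinations :: "('a \<times> 'a) set \<Rightarrow> ('a \<times> 'a) set" where
  "pair_combinations G =
     {(smul c x + smul d x', smul c y + smul d y') | c d x y x' y'. (x, y) \<in> G \<and> (x', y') \<in> G}"

lemma pair_combinationsI:
  "(x, y) \<in> G \<Longrightarrow> (x', y') \<in> G \<Longrightarrow>
     (smul c x + smul d x', smul c y + smul d y') \<in> pair_combinations G"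
  unfolding pair_combinations_def by blast

lemma jointly_approximable_pair_combinations:
  assumes T: "T \<in> cont_lin_ops smul UNIV" and G: "jointly_approximable T G"
  shows "jointly_approximable T (pair_combinations G)"
  unfolding jointly_approximable_def
proof (intro allI impI)
  fix \<W> :: "('a \<times> 'a) set set" and N :: nat
  assume \<W>: "finite \<W> \<and> (\<forall>W\<in>\<W>. open W \<and> W \<inter> pair_combinations G \<noteq> {})"
  have "\<exists>A B. open A \<and> open B \<and> A \<inter> G \<noteq> {} \<and> B \<inter> G \<noteq> {} \<and>
          (\<forall>m y z. (y, (T ^^ m) y) \<in> A \<longrightarrow> (z, (T ^^ m) z) \<in> B \<longrightarrow> (\<exists>w. (w, (T ^^ m) w) \<in> W))"
    if "W \<in> \<W>" for W
  proof -
    from \<W> that have "open W" and "W \<inter> pair_combinations G \<noteq> {}"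
      by auto
    then obtain c d x y x' y' where xy: "(x, y) \<in> G" "(x', y') \<in> G"
      and W: "(smul c x + smul d x', smul c y + smul d y') \<in> W"
      unfolding pair_combinations_def by blast
    define F where "F p = (smul c (fst (fst p)) + smul d (fst (snd p)),
        smul c (snd (fst p)) + smul d (snd (snd p)))" for p :: "('a \<times> 'a) \<times> ('a \<times> 'a)"
    have "continuous_on UNIV F"
      unfolding F_def by (intro continuous_intros)
    then have "open (F -` W)"
      using \<open>open W\<close> by (auto intro: open_vimage)
    moreover have "((x, y), (x', y')) \<in> F -` W"
      using W by (simp add: F_def)
    ultimately obtain A B where AB: "open A" "open B" "((x, y), (x', y')) \<in> A \<times> B" "A \<times> B \<subseteq> F -` W"
      by (rule open_prod_elim)
    \<comment> \<open>The graph of \<open>T\<^sup>m\<close> is a linear subspace, so it contains the combination of the two points.\<close>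
    have "\<exists>w. (w, (T ^^ m) w) \<in> W" if "(u, (T ^^ m) u) \<in> A" "(v, (T ^^ m) v) \<in> B" for m u v
    proof
      have "F ((u, (T ^^ m) u), (v, (T ^^ m) v)) \<in> W"
        using AB(4) that by blast
      moreover have "(T ^^ m) (smul c u + smul d v) = smul c ((T ^^ m) u) + smul d ((T ^^ m) v)"
        using funpow_cont_lin_ops[OF T, of m] by (simp add: cont_lin_ops_def)
      ultimately show "(smul c u + smul d v, (T ^^ m) (smul c u + smul d v)) \<in> W"
        by (simp add: F_def)
    qed
    moreover have "A \<inter> G \<noteq> {}" "B \<inter> G \<noteq> {}"
      using AB(3) xy by auto
    ultimately show ?thesis
      using AB(1,2) by (intro exI[of _ A] exI[of _ B] conjI allI impI)
  qed
  then obtain A B where AB: "\<And>W. W \<in> \<W> \<Longrightarrow> open (A W) \<and> open (B W) \<and> A W \<inter> G \<noteq> {} \<and> B W \<inter> G \<noteq> {} \<and>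
          (\<forall>m y z. (y, (T ^^ m) y) \<in> A W \<longrightarrow> (z, (T ^^ m) z) \<in> B W \<longrightarrow> (\<exists>w. (w, (T ^^ m) w) \<in> W))"
    by metis
  have "finite (A ` \<W> \<union> B ` \<W>)"
    using \<W> by simp
  moreover have "open V \<and> V \<inter> G \<noteq> {}" if "V \<in> A ` \<W> \<union> B ` \<W>" for V
    using AB that by auto
  ultimately obtain m where "m > N" and m: "\<forall>V\<in>A ` \<W> \<union> B ` \<W>. \<exists>y. (y, (T ^^ m) y) \<in> V"
    by (rule jointly_approximableE[OF G, where N = N])
  have "\<exists>w. (w, (T ^^ m) w) \<in> W" if "W \<in> \<W>" for W
  proof -
    obtain y where y: "(y, (T ^^ m) y) \<in> A W"
      using bspec[OF m, of "A W"] \<open>W \<in> \<W>\<close> by auto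
    obtain z where z: "(z, (T ^^ m) z) \<in> B W"
      using bspec[OF m, of "B W"] \<open>W \<in> \<W>\<close> by auto
    from AB[OF \<open>W \<in> \<W>\<close>] y z show ?thesis by metis
  qed
  with \<open>m > N\<close> show "\<exists>m>N. \<forall>W\<in>\<W>. \<exists>y. (y, (T ^^ m) y) \<in> W"
    by (intro exI[of _ m] conjI ballI)
qed

end

section \<open>Finite powers of the space\<close>

lemma coordwise_funpow:
  assumes "x \<in> power_space n"
  shows "(coordwise n (\<lambda>_. T) ^^ m) x = coordwise n (\<lambda>_. T ^^ m) x"
proof (induction m)
  case 0
  show ?case using assms by (auto simp: coordwise_def power_space_def)
next
  case (Suc m)
  then show ?case by (auto simp: coordwise_def)
qed

lemma continuous_on_coordwise:
  fixes g :: "nat \<Rightarrow> 'a::{zero,topological_space} \<Rightarrow> 'a"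
  assumes "\<And>i. i < n \<Longrightarrow> continuous_on UNIV (g i)"
  shows "continuous_on S (coordwise n g)"
proof (rule continuous_on_coordinatewise_then_product)
  fix i
  have "continuous_on S (\<lambda>x::nat \<Rightarrow> 'a. x i)"
    by (rule continuous_on_subset[OF continuous_on_product_coordinates]) simp
  then show "continuous_on S (\<lambda>x. coordwise n g x i)"
    using assms continuous_on_compose2[of UNIV "g i" S "\<lambda>x. x i"]
    by (cases "i < n") (auto simp: coordwise_def)
qed

lemma LIMSEQ_fun_iff:
  fixes f :: "nat \<Rightarrow> 'i \<Rightarrow> 'b::topological_space"
  shows "f \<longlonglongrightarrow> l \<longleftrightarrow> (\<forall>i. (\<lambda>k. f k i) \<longlonglongrightarrow> l i)"
  using limitin_componentwise[of "\<lambda>_. euclidean" UNIV f l sequentially]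
  by (simp add: euclidean_product_topology)

text \<open>
  A countable base of open neighbourhoods of zero. The type need not be an instance of a metric
  class, so the metric is only a witness inside the proof.
\<close>
lemma zero_neighbourhood_sequence:
  assumes "completely_metrizable_space (euclidean :: 'a::{zero,topological_space} topology)"
  obtains B :: "nat \<Rightarrow> 'a::{zero,topological_space} set" where "\<And>k. open (B k)" "\<And>k. 0 \<in> B k"
    "\<And>S. open S \<Longrightarrow> 0 \<in> S \<Longrightarrow> \<forall>\<^sub>F k in sequentially. B k \<subseteq> S"
proof -
  obtain M d where "Metric_space M d" and eq: "(euclidean :: 'a topology) = Metric_space.mtopology M d"
    using assms unfolding completely_metrizable_space_def by blast
  then interpret Metric_space M d by simp
  have M: "M = UNIV"
    using eq by (metis topspace_euclidean topspace_mtopology)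
  show thesis
  proof
    show "open (mball 0 (1 / Suc k))" for k
      unfolding open_openin eq by (rule openin_mball)
    show "0 \<in> mball 0 (1 / Suc k)" for k
      using M by (intro centre_in_mball_iff[THEN iffD2]) auto
    fix S :: "'a set" assume "open S" "0 \<in> S"
    then obtain r where r: "r > 0" "mball 0 r \<subseteq> S"
      unfolding open_openin eq openin_mtopology by blast
    have "\<forall>\<^sub>F k in sequentially. 1 / real (Suc k) < r"
      using r(1) by (rule order_tendstoD(2)[OF lim_1_over_n[THEN LIMSEQ_Suc]])
    then show "\<forall>\<^sub>F k in sequentially. mball 0 (1 / Suc k) \<subseteq> S"
    proof eventually_elim
      case (elim k)
      then have "mball 0 (1 / Suc k) \<subseteq> mball 0 r"
        by (intro mball_subset_concentric) simp
      with r(2) show ?case by (rule subset_trans[rotated])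
    qed
  qed
qed

lemma completely_metrizable_power_space:
  assumes "completely_metrizable_space (euclidean :: 'a::{zero,topological_space} topology)"
  shows "completely_metrizable_space (top_of_set (power_space n :: (nat \<Rightarrow> 'a) set))"
proof (rule completely_metrizable_space_closedin)
  show "completely_metrizable_space (euclidean :: (nat \<Rightarrow> 'a) topology)"
    using assms completely_metrizable_space_product_topology[of "\<lambda>_::nat. euclidean :: 'a topology" UNIV]
    by (simp add: euclidean_product_topology)
  have "closed {0::'a}"
    using metrizable_imp_t1_space[OF completely_metrizable_imp_metrizable_space[OF assms]]
    unfolding t1_space_closedin_singleton closed_closedin by simp
  then have "closed ((\<lambda>x::nat \<Rightarrow> 'a. x i) -` {0})" for i
    by (intro closed_vimage) auto
  moreover have "power_space n = (\<Inter>i\<in>{n..}. (\<lambda>x::nat \<Rightarrow> 'a. x i) -` {0})"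
    by (auto simp: power_space_def)
  ultimately show "closedin euclidean (power_space n :: (nat \<Rightarrow> 'a) set)"
    by auto
qed

section \<open>Simultaneous approximation in terms of graphs\<close>

lemma simultaneously_approximated_imp_jointly_approximable:
  fixes T :: "'a::{ab_group_add,topological_space} \<Rightarrow> 'a"
  assumes H: "simultaneously_approximated smul T H"
  shows "jointly_approximable T (graphs H)"
  unfolding jointly_approximable_def
proof (intro allI impI)
  fix \<W> :: "('a \<times> 'a) set set" and N :: nat
  assume \<W>: "finite \<W> \<and> (\<forall>W\<in>\<W>. open W \<and> W \<inter> graphs H \<noteq> {})"
  show "\<exists>m>N. \<forall>W\<in>\<W>. \<exists>y. (y, (T ^^ m) y) \<in> W"
  proof (cases "\<W> = {}")
    case False
    define n where "n = card \<W>"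
    have "n \<ge> 1"
      using \<W> False by (simp add: n_def Suc_le_eq card_gt_0_iff)
    obtain e where e: "bij_betw e {0..<n} \<W>"
      using \<W> ex_bij_betw_nat_finite unfolding n_def by blast
    then have e\<W>: "e i \<in> \<W>" if "i < n" for i
      using that by (auto simp: bij_betw_def)
    have "\<exists>h x. h \<in> H \<and> (x, h x) \<in> e i" if "i < n" for i
      using \<W> e\<W>[OF that] unfolding graphs_def by blast
    then obtain g u where g: "\<And>i. i < n \<Longrightarrow> g i \<in> H" and u: "\<And>i. i < n \<Longrightarrow> (u i, g i (u i)) \<in> e i"
      by metis
    have cont: "continuous_on UNIV (g i)" if "i < n" for i
      using H g[OF that] by (auto simp: simultaneously_approximated_def cont_lin_ops_def)
    define A where "A = {y \<in> power_space n. \<exists>\<omega>::nat \<Rightarrow> nat. strict_mono \<omega> \<and> (\<forall>k. \<omega> k > 0) \<and>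
        (\<lambda>k. (coordwise n (\<lambda>_. T) ^^ \<omega> k) y) \<longlonglongrightarrow> coordwise n g y}"
    have "coordwise n g \<in> Sigma_ops (pointwise_scale smul) (power_space n) (coordwise n (\<lambda>_. T))"
      using H g \<open>n \<ge> 1\<close> by (auto simp: simultaneously_approximated_def)
    then have dense: "power_space n \<subseteq> closure A"
      by (simp add: Sigma_ops_def A_def)
    \<comment> \<open>By continuity of the maps \<open>g i\<close>, the points whose graph points lie in the given open sets form
      an open set, which therefore contains a point of \<open>A\<close>.\<close>
    define Q where "Q = (\<Inter>i\<in>{..<n}. (\<lambda>y. (y i, g i (y i))) -` e i)"
    have "open ((\<lambda>y. (y i, g i (y i))) -` e i)" if "i < n" for i
      using \<W> e\<W>[OF that]
      by (intro open_vimage continuous_on_Pair continuous_on_compose2[OF cont[OF that]]) auto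
    then have "open Q"
      unfolding Q_def by auto
    moreover have "(\<lambda>i. if i < n then u i else 0) \<in> Q \<inter> closure A"
      using u dense by (auto simp: Q_def power_space_def)
    ultimately have "Q \<inter> A \<noteq> {}"
      by (metis empty_iff open_Int_closure_eq_empty)
    then obtain y \<omega> where y: "y \<in> Q" "y \<in> power_space n" and \<omega>: "strict_mono (\<omega> :: nat \<Rightarrow> nat)"
      and lim: "(\<lambda>k. (coordwise n (\<lambda>_. T) ^^ \<omega> k) y) \<longlonglongrightarrow> coordwise n g y"
      by (auto simp: A_def)
    have "\<forall>\<^sub>F k in sequentially. (y i, (T ^^ \<omega> k) (y i)) \<in> e i" if "i < n" for i
    proof (rule topological_tendstoD)
      have "(\<lambda>k. (coordwise n (\<lambda>_. T) ^^ \<omega> k) y i) \<longlonglongrightarrow> coordwise n g y i"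
        using lim by (simp add: LIMSEQ_fun_iff)
      then have "(\<lambda>k. (T ^^ \<omega> k) (y i)) \<longlonglongrightarrow> g i (y i)"
        using that by (simp add: coordwise_funpow[OF y(2)]) (simp add: coordwise_def)
      then show "(\<lambda>k. (y i, (T ^^ \<omega> k) (y i))) \<longlonglongrightarrow> (y i, g i (y i))"
        by (intro tendsto_intros)
      show "open (e i)" using \<W> e\<W>[OF that] by blast
      show "(y i, g i (y i)) \<in> e i" using y(1) that by (auto simp: Q_def)
    qed
    then have "\<forall>\<^sub>F k in sequentially. \<forall>i\<in>{..<n}. (y i, (T ^^ \<omega> k) (y i)) \<in> e i"
      by (intro eventually_ball_finite) auto
    then have "\<forall>\<^sub>F k in sequentially. k > N \<and> (\<forall>i\<in>{..<n}. (y i, (T ^^ \<omega> k) (y i)) \<in> e i)"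
      using eventually_gt_at_top[of N] by eventually_elim auto
    then obtain k where k: "k > N" "\<And>i. i < n \<Longrightarrow> (y i, (T ^^ \<omega> k) (y i)) \<in> e i"
      using eventually_happens'[OF sequentially_bot] by force
    have "\<omega> k > N"
      using k(1) strict_mono_imp_increasing[OF \<omega>, of k] by linarith
    moreover have "\<exists>z. (z, (T ^^ \<omega> k) z) \<in> W" if "W \<in> \<W>" for W
    proof -
      obtain i where "i < n" "e i = W"
        using e \<open>W \<in> \<W>\<close> by (auto simp: bij_betw_def image_iff)
      with k(2) show ?thesis by blast
    qed
    ultimately show ?thesis by blast
  qed auto
qed

lemma coordwise_cont_lin_ops:
  assumes "\<And>c. smul c 0 = 0" and g: "\<And>i. i < n \<Longrightarrow> g i \<in> cont_lin_ops smul UNIV"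
  shows "coordwise n g \<in> cont_lin_ops (pointwise_scale smul) (power_space n)"
proof -
  have "continuous_on (power_space n) (coordwise n g)"
    using g by (intro continuous_on_coordwise) (auto simp: cont_lin_ops_def)
  then show ?thesis
    using assms by (auto simp: cont_lin_ops_def coordwise_def power_space_def pointwise_scale_def fun_eq_iff)
qed

context F_space
begin

text \<open>
  The density of each of the open sets to which the Baire category theorem is applied below. For a
  fixed accuracy \<open>B\<close>, a power of \<open>T\<close> beyond \<open>N\<close> imitates each \<open>g i\<close> at the coordinates of some
  point near any given \<open>x\<close>.
\<close>
lemma jointly_approximable_imp_dense:
  fixes n :: nat
  assumes T: "T \<in> cont_lin_ops smul UNIV"
    and g: "\<And>i. i < n \<Longrightarrow> g i \<in> cont_lin_ops smul UNIV"
    and J: "\<And>x. jointly_approximable T {(x i, g i (x i)) | i. i < n}"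
    and B: "open B" "0 \<in> B"
  shows "power_space n \<subseteq> closure {y \<in> power_space n. \<exists>m>N. \<forall>i<n. (T ^^ m) (y i) - g i (y i) \<in> B}"
    (is "_ \<subseteq> closure ?D")
proof
  fix x :: "nat \<Rightarrow> 'a" assume x: "x \<in> power_space n"
  have cont: "continuous_on UNIV (g i)" if "i < n" for i
    using g[OF that] by (simp add: cont_lin_ops_def)
  have "Q \<inter> ?D \<noteq> {}" if Q: "open Q" "x \<in> Q" for Q
  proof -
    obtain U where xU: "x \<in> (\<Pi>\<^sub>E i\<in>UNIV. U i)" and U: "\<And>i. open (U i)" and UQ: "(\<Pi>\<^sub>E i\<in>UNIV. U i) \<subseteq> Q"
      using product_topology_open_contains_basis[OF Q(1)[unfolded open_fun_def] Q(2)]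
      by (auto simp flip: open_openin)
    \<comment> \<open>\<open>(p, q)\<close> lies in \<open>W i\<close> if \<open>p\<close> is close to \<open>x i\<close> and \<open>q\<close> is close to \<open>g i p\<close>, not merely to
      \<open>g i (x i)\<close>.\<close>
    define W where "W i = (\<lambda>(p, q). (p, q - g i p)) -` (U i \<times> B)" for i
    have "open (W i)" if "i < n" for i
    proof -
      have "continuous_on UNIV (\<lambda>z::'a \<times> 'a. (fst z, snd z - g i (fst z)))"
        by (intro continuous_on_Pair continuous_on_fst continuous_on_snd continuous_on_diff continuous_on_id
            continuous_on_compose2[OF cont[OF that]]) auto
      then show ?thesis
        unfolding W_def using U B(1) by (intro open_vimage open_Times) (auto simp: case_prod_unfold)
    qed
    moreover have "(x i, g i (x i)) \<in> W i" for i
      using xU B(2) by (auto simp: W_def)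
    ultimately have "open V \<and> V \<inter> {(x i, g i (x i)) | i. i < n} \<noteq> {}" if "V \<in> W ` {..<n}" for V
      using that by blast
    then obtain m where m: "m > N" "\<forall>V\<in>W ` {..<n}. \<exists>z. (z, (T ^^ m) z) \<in> V"
      by (rule jointly_approximableE[OF J finite_imageI[OF finite_lessThan], where N = N])
    have "\<forall>i\<in>{..<n}. \<exists>z. (z, (T ^^ m) z) \<in> W i"
      using m(2) by simp
    then obtain z where z: "\<And>i. i < n \<Longrightarrow> (z i, (T ^^ m) (z i)) \<in> W i"
      by (metis lessThan_iff)
    \<comment> \<open>Coordinates from \<open>n\<close> on are set to zero, where they agree with those of \<open>x\<close>.\<close>
    define y where "y i = (if i < n then z i else 0)" for i
    have "y \<in> ?D"
      using m(1) z by (auto simp: y_def power_space_def W_def)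
    moreover have "y i \<in> U i" for i
    proof (cases "i < n")
      case True
      then show ?thesis using z[OF True] by (simp add: y_def W_def)
    next
      case False
      then have "y i = x i" using x by (simp add: y_def power_space_def)
      then show ?thesis using xU by auto
    qed
    ultimately show ?thesis using UQ by blast
  qed
  then show "x \<in> closure ?D"
    unfolding closure_iff_nhds_not_empty by blast
qed

lemma jointly_approximable_imp_simultaneously_approximated:
  assumes T: "T \<in> cont_lin_ops smul UNIV" and H: "H \<subseteq> cont_lin_ops smul UNIV"
    and J: "jointly_approximable T (graphs H)"
  shows "simultaneously_approximated smul T H"
  unfolding simultaneously_approximated_def
proof (intro conjI H allI impI)
  fix n :: nat and g :: "nat \<Rightarrow> 'a \<Rightarrow> 'a"
  assume gH: "\<forall>i<n. g i \<in> H"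
  then have g: "g i \<in> cont_lin_ops smul UNIV" if "i < n" for i
    using H that by blast
  obtain B :: "nat \<Rightarrow> 'a set" where B: "\<And>k. open (B k)" "\<And>k. 0 \<in> B k"
    and B_small: "\<And>S. open S \<Longrightarrow> 0 \<in> S \<Longrightarrow> \<forall>\<^sub>F k in sequentially. B k \<subseteq> S"
    using zero_neighbourhood_sequence[OF completely_metrizable] by blast
  define V where "V = (power_space n :: (nat \<Rightarrow> 'a) set)"
  define A where "A = {y \<in> V. \<exists>\<omega>::nat \<Rightarrow> nat. strict_mono \<omega> \<and> (\<forall>k. \<omega> k > 0) \<and>
      (\<lambda>k. (coordwise n (\<lambda>_. T) ^^ \<omega> k) y) \<longlonglongrightarrow> coordwise n g y}"
  define D where "D = (\<lambda>(N, k). {y \<in> V. \<exists>m>N. \<forall>i<n. (T ^^ m) (y i) - g i (y i) \<in> B k})"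
  have dense: "V \<subseteq> closure (D (N, k))" for N k
  proof -
    have "jointly_approximable T {(x i, g i (x i)) | i. i < n}" for x
      using J by (rule jointly_approximable_mono) (use gH in \<open>auto intro: graphsI\<close>)
    from jointly_approximable_imp_dense[OF T g this B(1) B(2)] show ?thesis
      by (simp add: D_def V_def)
  qed
  have open_D: "openin (top_of_set V) (D (N, k))" for N k
  proof -
    have "open ((\<lambda>y. (T ^^ m) (y i) - g i (y i)) -` B k)" if "i < n" for m i
    proof -
      have "continuous_on UNIV (T ^^ m)" "continuous_on UNIV (g i)"
        using funpow_cont_lin_ops[OF T, of m] g[OF that] by (auto simp: cont_lin_ops_def)
      then have "continuous_on UNIV (\<lambda>y::nat \<Rightarrow> 'a. (T ^^ m) (y i) - g i (y i))"
        by (intro continuous_on_diff) (erule continuous_on_compose2, simp_all)+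
      then show ?thesis using B(1) by (auto intro: open_vimage)
    qed
    then have "open (\<Union>m\<in>{N<..}. \<Inter>i\<in>{..<n}. (\<lambda>y. (T ^^ m) (y i) - g i (y i)) -` B k)"
      by (intro open_UN ballI open_INT) auto
    moreover have "D (N, k) = V \<inter> (\<Union>m\<in>{N<..}. \<Inter>i\<in>{..<n}. (\<lambda>y. (T ^^ m) (y i) - g i (y i)) -` B k)"
      by (auto simp: D_def)
    ultimately show ?thesis by (simp add: openin_open_Int)
  qed
  \<comment> \<open>A point of all the sets \<open>D (N, k)\<close> has exponents of any size and accuracy, from which a strictly
    increasing sequence is extracted; by Baire such points are dense.\<close>
  have "top_of_set V closure_of \<Inter>(range D) = topspace (top_of_set V)"
  proof (rule Baire_category)
    show "completely_metrizable_space (top_of_set V) \<or>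
        locally_compact_space (top_of_set V) \<and> regular_space (top_of_set V)"
      using completely_metrizable_power_space[OF completely_metrizable] by (simp add: V_def)
    fix S assume "S \<in> range D"
    then obtain N k where S: "S = D (N, k)" by auto
    have "S \<subseteq> V" by (auto simp: S D_def)
    with dense[of N k] open_D[of N k] S
    show "openin (top_of_set V) S \<and> top_of_set V closure_of S = topspace (top_of_set V)"
      by (simp add: closure_of_subtopology inf_absorb1 inf_absorb2 Int_absorb1)
  qed simp
  then have "V \<subseteq> closure (V \<inter> \<Inter>(range D))"
    by (auto simp: closure_of_subtopology)
  moreover have "V \<inter> \<Inter>(range D) \<subseteq> A"
  proof
    fix y assume y: "y \<in> V \<inter> \<Inter>(range D)"
    have next_m: "\<exists>m>N. \<forall>i<n. (T ^^ m) (y i) - g i (y i) \<in> B k" for N k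
    proof -
      have "y \<in> D (N, k)" using y by blast
      then show ?thesis by (simp add: D_def)
    qed
    define P where "P k m \<longleftrightarrow> m > 0 \<and> (\<forall>i<n. (T ^^ m) (y i) - g i (y i) \<in> B k)" for k m
    have "\<exists>\<omega>. \<forall>k. P k (\<omega> k) \<and> \<omega> k < \<omega> (Suc k)"
    proof (rule dependent_nat_choice)
      show "\<exists>m. P 0 m" using next_m[of 0 0] by (auto simp: P_def)
      show "\<exists>m'. P (Suc k) m' \<and> m < m'" for m k
        using next_m[of m "Suc k"] by (metis P_def bot_nat_0.extremum order_le_less_trans)
    qed
    then obtain \<omega> where \<omega>: "\<And>k. P k (\<omega> k)" "\<And>k. \<omega> k < \<omega> (Suc k)" by blast
    have conv: "(\<lambda>k. (T ^^ \<omega> k) (y i)) \<longlonglongrightarrow> g i (y i)" if "i < n" for i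
    proof -
      have "(\<lambda>k. (T ^^ \<omega> k) (y i) - g i (y i)) \<longlonglongrightarrow> 0"
      proof (rule topological_tendstoI)
        fix S :: "'a set" assume "open S" "0 \<in> S"
        from B_small[OF this] show "\<forall>\<^sub>F k in sequentially. (T ^^ \<omega> k) (y i) - g i (y i) \<in> S"
          by eventually_elim (use \<omega>(1) that in \<open>auto simp: P_def\<close>)
      qed
      from tendsto_add[OF this tendsto_const[of "g i (y i)"]] show ?thesis by simp
    qed
    have yV: "y \<in> power_space n" using y by (simp add: V_def)
    have "(\<lambda>k. (coordwise n (\<lambda>_. T) ^^ \<omega> k) y) \<longlonglongrightarrow> coordwise n g y"
      unfolding LIMSEQ_fun_iff coordwise_funpow[OF yV] using conv by (simp add: coordwise_def)
    moreover have "strict_mono \<omega>" using \<omega>(2) by (simp add: strict_mono_Suc_iff)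
    moreover have "\<forall>k. \<omega> k > 0" using \<omega>(1) by (simp add: P_def)
    ultimately show "y \<in> A" using yV by (auto simp: A_def V_def)
  qed
  ultimately have "V \<subseteq> closure A"
    using closure_mono by blast
  moreover have "coordwise n g \<in> cont_lin_ops (pointwise_scale smul) (power_space n)"
    by (rule coordwise_cont_lin_ops) (auto intro: g scale_zero_right)
  ultimately show "coordwise n g \<in> Sigma_ops (pointwise_scale smul) (power_space n) (coordwise n (\<lambda>_. T))"
    by (simp add: Sigma_ops_def A_def V_def)
qed

section \<open>Maximal collections\<close>

text \<open>
  The operators with graph in a jointly approximable set \<open>G\<close> are simultaneously approximated, so a
  maximal collection with graphs in \<open>G\<close> already contains all of them.
\<close>
lemma maximal_simultaneously_approximated_eq:
  assumes T: "T \<in> cont_lin_ops smul UNIV" and M: "maximal_simultaneously_approximated smul T M"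
    and G: "jointly_approximable T G" "graphs M \<subseteq> G"
  shows "M = {h \<in> cont_lin_ops smul UNIV. \<forall>x. (x, h x) \<in> G}" (is "M = ?M'")
proof -
  have "simultaneously_approximated smul T M" 
    using M by (simp add: maximal_simultaneously_approximated_def)
  then have "M \<subseteq> ?M'"
    using G(2) by (auto simp: simultaneously_approximated_def intro: graphsI)
  moreover have "simultaneously_approximated smul T ?M'"
    using G(1)
    by (intro jointly_approximable_imp_simultaneously_approximated[OF T] jointly_approximable_mono[OF G(1)])
      (auto simp: graphs_def)
  ultimately show ?thesis
    using M unfolding maximal_simultaneously_approximated_def by blast
qed

lemma maximal_simultaneously_approximated_closed:
  assumes T: "T \<in> cont_lin_ops smul UNIV" and M: "maximal_simultaneously_approximated smul T M"
  shows "closedin (SOT smul) M"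
proof -
  have "jointly_approximable T (graphs M)"
    using M by (auto simp: maximal_simultaneously_approximated_def
        intro: simultaneously_approximated_imp_jointly_approximable)
  then have eq: "M = {h \<in> cont_lin_ops smul UNIV. \<forall>x. (x, h x) \<in> closure (graphs M)}"
    by (intro maximal_simultaneously_approximated_eq[OF T M] jointly_approximable_closure closure_subset)
  have "closed ((\<lambda>h::'a \<Rightarrow> 'a. (x, h x)) -` closure (graphs M))" for x
    by (intro closed_vimage continuous_on_Pair) auto
  then have "closed (\<Inter>x. (\<lambda>h::'a \<Rightarrow> 'a. (x, h x)) -` closure (graphs M))"
    by auto
  moreover have "M = cont_lin_ops smul UNIV \<inter> (\<Inter>x. (\<lambda>h. (x, h x)) -` closure (graphs M))"
    by (subst eq) auto
  ultimately show ?thesis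
    unfolding SOT_def euclidean_product_topology closedin_closed by blast
qed

lemma linear_combination_cont_lin_ops:
  assumes "a \<in> cont_lin_ops smul UNIV" "b \<in> cont_lin_ops smul UNIV"
  shows "pointwise_scale smul c a + pointwise_scale smul d b \<in> cont_lin_ops smul UNIV"
proof -
  have "continuous_on UNIV (\<lambda>x. smul c (a x) + smul d (b x))"
    using assms by (intro continuous_intros) (auto simp: cont_lin_ops_def)
  then show ?thesis
    using assms
    by (auto simp: cont_lin_ops_def pointwise_scale_def plus_fun_def scale_right_distrib
        scale_left_commute mult.commute add_ac)
qed

lemma maximal_simultaneously_approximated_affine:
  assumes T: "T \<in> cont_lin_ops smul UNIV" and M: "maximal_simultaneously_approximated smul T M"
  shows "affine_manifold (pointwise_scale smul) M"
  unfolding affine_manifold_def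
proof (intro ballI allI)
  fix a b t assume ab: "a \<in> M" "b \<in> M"
  have "graphs M \<subseteq> pair_combinations (graphs M)"
  proof
    fix p assume "p \<in> graphs M"
    moreover have "p = (smul 1 (fst p) + smul 0 (fst p), smul 1 (snd p) + smul 0 (snd p))"
      by simp
    ultimately show "p \<in> pair_combinations (graphs M)"
      using pair_combinationsI[of "fst p" "snd p" "graphs M" "fst p" "snd p" 1 0] by simp
  qed
  moreover have "jointly_approximable T (graphs M)"
    using M by (auto simp: maximal_simultaneously_approximated_def
        intro: simultaneously_approximated_imp_jointly_approximable)
  ultimately have eq: "M = {h \<in> cont_lin_ops smul UNIV. \<forall>x. (x, h x) \<in> pair_combinations (graphs M)}"
    by (intro maximal_simultaneously_approximated_eq[OF T M] jointly_approximable_pair_combinations[OF T])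
  let ?h = "pointwise_scale smul (1 - t) a + pointwise_scale smul t b"
  have "(x, ?h x) \<in> pair_combinations (graphs M)" for x
  proof -
    have "x = smul (1 - t) x + smul t x"
      by (simp flip: scale_left_distrib)
    then show ?thesis
      using pair_combinationsI[OF graphsI[OF ab(1), of x] graphsI[OF ab(2), of x], of "1 - t" t]
      by (simp add: pointwise_scale_def plus_fun_def)
  qed
  moreover have "?h \<in> cont_lin_ops smul UNIV"
    using ab eq by (intro linear_combination_cont_lin_ops) auto
  ultimately show "?h \<in> M"
    by (subst eq) simp
qed

end

theorem theorem3p16:
  shows "(\<forall>(smul :: real \<Rightarrow> 'a::topological_ab_group_add \<Rightarrow> 'a) T M.
            F_space smul \<and> separable_space (euclidean :: 'a topology) \<and> infinite_dimensional smul \<and>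
            T \<in> cont_lin_ops smul UNIV \<and> maximal_simultaneously_approximated smul T M \<longrightarrow>
            closedin (SOT smul) M \<and> affine_manifold (pointwise_scale smul) M)
       \<and> (\<forall>(smul :: complex \<Rightarrow> 'a \<Rightarrow> 'a) T M.
            F_space smul \<and> separable_space (euclidean :: 'a topology) \<and> infinite_dimensional smul \<and>
            T \<in> cont_lin_ops smul UNIV \<and> maximal_simultaneously_approximated smul T M \<longrightarrow>
            closedin (SOT smul) M \<and> affine_manifold (pointwise_scale smul) M)"
proof (intro conjI allI impI; (elim conjE)?)
  fix smul :: "real \<Rightarrow> 'a \<Rightarrow> 'a" and T M
  assume *: "F_space smul" "T \<in> cont_lin_ops smul UNIV" "maximal_simultaneously_approximated smul T M"
  show "closedin (SOT smul) M"
    by (rule F_space.maximal_simultaneously_approximated_closed[OF *])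
  show "affine_manifold (pointwise_scale smul) M"
    by (rule F_space.maximal_simultaneously_approximated_affine[OF *])
next
  fix smul :: "complex \<Rightarrow> 'a \<Rightarrow> 'a" and T M
  assume *: "F_space smul" "T \<in> cont_lin_ops smul UNIV" "maximal_simultaneously_approximated smul T M"
  show "closedin (SOT smul) M"
    by (rule F_space.maximal_simultaneously_approximated_closed[OF *])
  show "affine_manifold (pointwise_scale smul) M"
    by (rule F_space.maximal_simultaneously_approximated_affine[OF *])
qed

end
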